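(* Let $X$ be a nonempty, at most countable set and let $w=\{w_{xy}\mid x,y\in X\}$ be a family of symmetric lower semicontinuous convex functions $w_{xy}\colon\mathbb R\to[0,\infty]$ with $w_{xy}(0)=0$ and $w_{xy}=w_{yx}$ for all $x,y\in X$. Define $$\mathcal E_w\colon\mathcal F(X)\to[0,\infty],\qquad\mathcal E_w(f)=\sum_{x,y\in X}w_{xy}(f(x)-f(y)).$$ Let $G_w$ be the graph with vertex set $X$ in which $x,y\in X$ are neighbors if and only if $w_{xy}\neq0$ (i.e. $w_{xy}$ is not identically zero). (a) $\mathcal E_w$ is a nonlinear resistance form if and only if $G_w$ is connected. (b) If for each $x\in X$ there exists $t>0$ with $\sum_{y\in X}w_{xy}(t)<\infty$, then $\mathcal F_c(X)\subset M(\mathcal E_w)$ and $D(\mathcal E_w)$ separates the points of $X$.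
   Context: $\mathcal F(X)$ is the real vector space of all functions $f\colon X\to\mathbb R$, equipped with the topology of pointwise convergence, and $\mathcal F_c(X)$ is the subspace of finitely supported functions. A function $h\colon\mathbb R\to[0,\infty]$ is symmetric if $h(s)=h(-s)$ for all $s$. A functional $\mathcal E\colon\mathcal F(X)\to[0,\infty]$ is called a nonlinear resistance form if: (1) $\mathcal E$ is convex with $\mathcal E(0)=0$; (2) $\mathcal E$ is lower semicontinuous with respect to pointwise convergence, i.e. $\mathcal E(f)\le\liminf_i\mathcal E(f_i)$ for every net $f_i\to f$ pointwise; (3) $R(x,y)<\infty$ for all $x,y\in X$, where $R(x,y)=\sup\{f(x)-f(y)\mid\mathcal E(f)\le1\}$; (4) all normal contractions operate on $\mathcal E$, i.e. for every $1$-Lipschitz $C\colon\mathbb R\to\mathbb R$ with $C(0)=0$ and all $f,g\in\mathcal F(X)$, $\mathcal E(f+C\circ g)+\mathcal E(f-C\circ g)\le\mathcal E(f+g)+\mathcal E(f-g)$. $D(\mathcal E)=\{f\in\mathcal F(X)\mid\mathcal E(f)<\infty\}$ and $M(\mathcal E)=\{f\in\mathcal F(X)\mid\lim_{\alpha\to0+}\mathcal E(\alpha f)=0\}$. *)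

theory Defs
  imports "Graph_Theory.Pair_Digraph" "Graph_Theory.Digraph_Component" "HOL-Analysis.Analysis"
begin

text \<open>
  The underlying set \<open>X\<close> is the universe of a type \<open>'x\<close>, so that \<open>'x \<Rightarrow> real\<close> is the space of all
  functions on \<open>X\<close>. Its topology, from \<open>Function_Topology\<close>, is that of pointwise convergence. Values
  in \<open>[0,\<infinity>]\<close> have type \<open>ennreal\<close>, where \<open>0 * \<infinity> = 0\<close>.
\<close>

lemma tendsto_fun_iff_pointwise:
  fixes f :: "'x \<Rightarrow> real"
  shows "(u \<longlongrightarrow> f) F \<longleftrightarrow> (\<forall>x. ((\<lambda>i. u i x) \<longlongrightarrow> f x) F)"
proof -
  have "(u \<longlongrightarrow> f) F \<longleftrightarrow> limitin (product_topology (\<lambda>_. euclidean) UNIV) u f F"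
    by (auto simp: limitin_def tendsto_def open_fun_def)
  then show ?thesis
    by (simp add: limitin_componentwise)
qed

text \<open>
  Nets are represented by filters: a net in \<open>'a\<close> corresponds to the filter of sets in which it
  eventually lies, which has the same limits and the same inferior limits of \<open>h\<close>.
  Lemma \<open>lsc_tendsto\<close> is the version for an arbitrarily indexed family.
\<close>
definition lsc :: "('a::topological_space \<Rightarrow> ennreal) \<Rightarrow> bool" where
  "lsc h \<longleftrightarrow> (\<forall>x F. ((\<lambda>y. y) \<longlongrightarrow> x) F \<longrightarrow> h x \<le> Liminf F h)"

lemma lsc_tendsto:
  assumes "lsc h" "(u \<longlongrightarrow> x) F"
  shows "h x \<le> Liminf F (\<lambda>i. h (u i))"
proof -
  have "((\<lambda>y. y) \<longlongrightarrow> x) (filtermap u F)"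
    using assms(2) by (simp add: filterlim_def filtermap_filtermap)
  with assms(1) have "h x \<le> Liminf (filtermap u F) h"
    by (auto simp: lsc_def)
  also have "\<dots> \<le> Liminf F (\<lambda>i. h (u i))"
    by (rule Liminf_filtermap_le)
  finally show ?thesis .
qed

text \<open>The library's \<open>convex_on\<close> is only available for functions with finite real values.\<close>
definition convex_ext :: "(real \<Rightarrow> ennreal) \<Rightarrow> bool" where
  "convex_ext h \<longleftrightarrow> (\<forall>s t. \<forall>u\<ge>0. \<forall>v\<ge>0. u + v = 1 \<longrightarrow>
     h (u * s + v * t) \<le> ennreal u * h s + ennreal v * h t)"

definition convex_functional :: "(('x \<Rightarrow> real) \<Rightarrow> ennreal) \<Rightarrow> bool" where
  "convex_functional E \<longleftrightarrow> (\<forall>f g. \<forall>u\<ge>0. \<forall>v\<ge>0. u + v = 1 \<longrightarrow>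
     E (\<lambda>x. u * f x + v * g x) \<le> ennreal u * E f + ennreal v * E g)"

definition resistance :: "(('x \<Rightarrow> real) \<Rightarrow> ennreal) \<Rightarrow> 'x \<Rightarrow> 'x \<Rightarrow> ereal" where
  "resistance E x y = (SUP f \<in> {f. E f \<le> 1}. ereal (f x - f y))"

definition nonlinear_resistance_form :: "(('x \<Rightarrow> real) \<Rightarrow> ennreal) \<Rightarrow> bool" where
  "nonlinear_resistance_form E \<longleftrightarrow>
     convex_functional E \<and> E (\<lambda>_. 0) = 0 \<and>
     lsc E \<and>
     (\<forall>x y. resistance E x y < \<infinity>) \<and>
     (\<forall>C :: real \<Rightarrow> real. 1-lipschitz_on UNIV C \<and> C 0 = 0 \<longrightarrow>
        (\<forall>f g. E (\<lambda>x. f x + C (g x)) + E (\<lambda>x. f x - C (g x))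
             \<le> E (\<lambda>x. f x + g x) + E (\<lambda>x. f x - g x)))"

definition domain_D :: "(('x \<Rightarrow> real) \<Rightarrow> ennreal) \<Rightarrow> ('x \<Rightarrow> real) set" where
  "domain_D E = {f. E f < \<infinity>}"

definition modular_M :: "(('x \<Rightarrow> real) \<Rightarrow> ennreal) \<Rightarrow> ('x \<Rightarrow> real) set" where
  "modular_M E = {f. ((\<lambda>\<alpha>. E (\<lambda>x. \<alpha> * f x)) \<longlongrightarrow> 0) (at_right 0)}"

definition finitely_supported :: "('x \<Rightarrow> real) set" where
  "finitely_supported = {f. finite {x. f x \<noteq> 0}}"

definition separates_points :: "('x \<Rightarrow> real) set \<Rightarrow> bool" where
  "separates_points A \<longleftrightarrow> (\<forall>x y. x \<noteq> y \<longrightarrow> (\<exists>f\<in>A. f x \<noteq> f y))"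

definition graph_energy :: "('x \<Rightarrow> 'x \<Rightarrow> real \<Rightarrow> ennreal) \<Rightarrow> ('x \<Rightarrow> real) \<Rightarrow> ennreal" where
  "graph_energy w f = (\<Sum>\<^sub>\<infinity>(x, y). w x y (f x - f y))"

text \<open>
  Undirected graphs are represented by digraphs with a symmetric arc relation. A loop at \<open>x\<close>, present
  if \<open>w x x\<close> is nonzero, does not affect connectedness.
\<close>
definition weight_graph :: "('x \<Rightarrow> 'x \<Rightarrow> real \<Rightarrow> ennreal) \<Rightarrow> 'x pair_pre_digraph" where
  "weight_graph w = \<lparr> pverts = UNIV, parcs = {(x, y). w x y \<noteq> (\<lambda>_. 0)} \<rparr>"

end

(*
  Everything reduces to single edges. A normal contraction replaces the increment b = g x - g y by
  some c with |c| <= |b|; then a + c and a - c are mirrored convex combinations of a + b and a - b,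
  where a = f x - f y, so convexity of w x y gives the contraction inequality edge by edge.
  On an edge, w x y is convex, even, and nonzero, so it exceeds 1 outside a bounded interval, which
  bounds the increments of functions of energy at most 1; adding up along a path gives finite
  resistance. If the graph is disconnected, all multiples of the indicator of a component have
  energy 0, so a resistance is infinite.
  For a finitely supported f, a small multiple has increments below the radii t of the finitely
  many points of the support, hence finite energy, and E (u f) <= u E f for 0 <= u <= 1.
*)

theory Submission
  imports Defs
begin

section \<open>Inferior limits and infinite sums in [0,\<infinity>]\<close>

text \<open>Eventual predicates are closed under conjunction, so the infima defining the two
  inferior limits form directed families and the sum of their suprema is a single supremum.\<close>

lemma Liminf_add_le_ennreal:
  fixes f g :: "'a \<Rightarrow> ennreal"
  shows "Liminf F f + Liminf F g \<le> Liminf F (\<lambda>x. f x + g x)"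
proof -
  have "Liminf F f + Liminf F g =
      (SUP P\<in>{P. eventually P F}. Inf (f ` Collect P) + Inf (g ` Collect P))"
    unfolding Liminf_def
  proof (rule SUP_add_directed_ennreal[symmetric])
    fix P Q assume "P \<in> {P. eventually P F}" "Q \<in> {P. eventually P F}"
    then have "(\<lambda>x. P x \<and> Q x) \<in> {P. eventually P F}"
      by (simp add: eventually_conj)
    moreover have "Inf (f ` Collect P) + Inf (g ` Collect Q)
        \<le> Inf (f ` {x. P x \<and> Q x}) + Inf (g ` {x. P x \<and> Q x})"
      by (intro add_mono INF_superset_mono) auto
    ultimately show "\<exists>R\<in>{P. eventually P F}.
        Inf (f ` Collect P) + Inf (g ` Collect Q) \<le> Inf (f ` Collect R) + Inf (g ` Collect R)"
      by blast
  qed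
  also have "\<dots> \<le> Liminf F (\<lambda>x. f x + g x)"
    unfolding Liminf_def
    by (intro SUP_mono' INF_greatest add_mono INF_lower)
  finally show ?thesis .
qed

lemma Liminf_sum_le_ennreal:
  fixes f :: "'i \<Rightarrow> 'a \<Rightarrow> ennreal"
  shows "(\<Sum>i\<in>I. Liminf F (f i)) \<le> Liminf F (\<lambda>x. \<Sum>i\<in>I. f i x)"
proof (induction I rule: infinite_finite_induct)
  case (insert i I)
  have "(\<Sum>i\<in>insert i I. Liminf F (f i)) \<le> Liminf F (f i) + Liminf F (\<lambda>x. \<Sum>i\<in>I. f i x)"
    using insert by (simp add: add_left_mono)
  also have "\<dots> \<le> Liminf F (\<lambda>x. f i x + (\<Sum>i\<in>I. f i x))"
    by (rule Liminf_add_le_ennreal)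
  finally show ?case
    using insert by simp
qed (auto intro: Liminf_bounded)

(* The library fact named summable_on_ennreal is actually about coerced enat-valued functions. *)
lemma ennreal_summable_on [simp]:
  fixes f :: "'a \<Rightarrow> ennreal"
  shows "f summable_on A"
  by (rule nonneg_summable_on_complete) simp

lemma infsum_mono_ennreal:
  fixes f g :: "'a \<Rightarrow> ennreal"
  assumes "\<And>x. x \<in> A \<Longrightarrow> f x \<le> g x"
  shows "infsum f A \<le> infsum g A"
  using assms by (intro infsum_mono) auto

lemma infsum_add_ennreal:
  fixes f g :: "'a \<Rightarrow> ennreal"
  shows "(\<Sum>\<^sub>\<infinity>x\<in>A. f x + g x) = infsum f A + infsum g A"
  by (rule infsum_add) simp_all

lemma finite_sum_le_infsum_ennreal:
  fixes f :: "'a \<Rightarrow> ennreal"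
  assumes "finite F" "F \<subseteq> A"
  shows "sum f F \<le> infsum f A"
  using assms by (subst nonneg_infsum_complete) (auto intro: SUP_upper)

text \<open>Only finite partial sums have to commute with \<open>c\<close>, which is distributivity;
  this covers \<open>c = top\<close> as well.\<close>

lemma infsum_cmult_le_ennreal:
  fixes f :: "'a \<Rightarrow> ennreal"
  shows "(\<Sum>\<^sub>\<infinity>x\<in>A. c * f x) \<le> c * infsum f A"
proof (rule infsum_le_finite_sums)
  fix F assume "finite F" "F \<subseteq> A"
  then have "sum f F \<le> infsum f A"
    by (intro finite_sum_le_infsum_ennreal) auto
  then show "(\<Sum>x\<in>F. c * f x) \<le> c * infsum f A"
    by (simp add: sum_distrib_left[symmetric] mult_left_mono)
qed simp

section \<open>Convex functions on the real line\<close>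

lemma convex_extD:
  assumes "convex_ext h" "0 \<le> u" "0 \<le> v" "u + v = 1"
  shows "h (u * s + v * t) \<le> ennreal u * h s + ennreal v * h t"
  using assms unfolding convex_ext_def by blast

lemma convex_ext_scale:
  assumes "convex_ext h" "h 0 = 0" "0 \<le> u" "u \<le> 1"
  shows "h (u * s) \<le> ennreal u * h s"
  using convex_extD[OF assms(1), of u "1 - u" s 0] assms by simp

text \<open>Evenness reduces the claim to absolute values, and \<bar>s\<bar> lies on the segment
  from 0, where \<open>h\<close> vanishes, to \<bar>t\<bar>.\<close>

lemma convex_ext_mono:
  assumes "convex_ext h" "\<And>s. h (- s) = h s" "h 0 = 0" "\<bar>s\<bar> \<le> \<bar>t\<bar>"
  shows "h s \<le> h t"
proof -
  have "h \<bar>s\<bar> \<le> h \<bar>t\<bar>"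
  proof (cases "t = 0")
    case False
    let ?u = "\<bar>s\<bar> / \<bar>t\<bar>"
    have "h (?u * \<bar>t\<bar>) \<le> ennreal ?u * h \<bar>t\<bar>"
      using assms False by (intro convex_ext_scale) auto
    also have "\<dots> \<le> 1 * h \<bar>t\<bar>"
      using assms(4) False by (intro mult_right_mono) auto
    finally show ?thesis
      using False by simp
  qed (use assms in auto)
  then show ?thesis
    using assms(2) by (auto simp: abs_if split: if_splits)
qed

lemma convex_ext_contraction:
  assumes "convex_ext h" "\<bar>c\<bar> \<le> \<bar>b\<bar>"
  shows "h (a + c) + h (a - c) \<le> h (a + b) + h (a - b)"
\<comment> \<open>If \<open>b = 0\<close>, then also \<open>c = 0\<close> and both sides
  agree.\<close>
proof (cases "b = 0")
  case False
  \<comment> \<open>These weights solve \<open>u + v = 1\<close> and \<open>(u - v) * b = c\<close>;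
    they are nonnegative because \<bar>c\<bar> \<le> \<bar>b\<bar>.\<close>
  define u where "u = (b + c) / (2 * b)"
  define v where "v = (b - c) / (2 * b)"
  have uv: "0 \<le> u" "0 \<le> v" "u + v = 1"
    using False assms(2)
    by (simp_all add: u_def v_def zero_le_divide_iff add_divide_distrib[symmetric], linarith+)
  have "u - v = c / b"
    using False by (simp add: u_def v_def field_simps)
  then have c: "(u - v) * b = c"
    using False by simp
  have "a + c = (u + v) * a + (u - v) * b" "a - c = (u + v) * a - (u - v) * b"
    using c uv by simp_all
  then have ac: "a + c = u * (a + b) + v * (a - b)" "a - c = v * (a + b) + u * (a - b)"
    by (simp_all add: algebra_simps)
  have "h (a + c) + h (a - c) \<le> (ennreal u * h (a + b) + ennreal v * h (a - b))
      + (ennreal v * h (a + b) + ennreal u * h (a - b))"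
    unfolding ac using uv by (intro add_mono convex_extD assms) auto
  also have "\<dots> = (ennreal u + ennreal v) * (h (a + b) + h (a - b))"
    by (simp add: algebra_simps)
  also have "\<dots> = h (a + b) + h (a - b)"
    using uv by (simp flip: ennreal_plus)
  finally show ?thesis .
qed (use assms in simp)

text \<open>By convexity and \<open>h 0 = 0\<close>, \<open>n * h s0\<close> is at most
  \<open>h (n * s0)\<close>, so a nonzero value forces \<open>h\<close> above 1 far enough out, and
  monotonicity in \<bar>s\<bar> keeps it there.\<close>

lemma convex_ext_bounded_sublevel:
  assumes h: "convex_ext h" "\<And>s. h (- s) = h s" "h 0 = 0" and "h \<noteq> (\<lambda>_. 0)"
  obtains T where "\<And>s. h s \<le> 1 \<Longrightarrow> \<bar>s\<bar> \<le> T"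
proof -
  from assms(4) obtain s0 where s0: "h s0 \<noteq> 0"
    by (auto simp: fun_eq_iff)
  \<comment> \<open>For a finite nonzero value this is the Archimedean property; for the value
    \<open>top\<close>, \<open>n = 1\<close> will do.\<close>
  then obtain n :: nat where n: "1 < of_nat n * h s0" "n > 0"
  proof (cases "h s0 = top")
    case True
    then show ?thesis
      using that[of 1] by simp
  next
    case False
    then obtain r where r: "h s0 = ennreal r" "r > 0"
      using s0 by (cases "h s0") (auto simp: less_le)
    then obtain n :: nat where "1 < real n * r"
      using ex_less_of_nat_mult by blast
    moreover have "of_nat n * h s0 = ennreal (real n * r)"
      using r by (simp add: ennreal_mult ennreal_of_nat_eq_real_of_nat)
    ultimately show ?thesis
      by (intro that[of n]) (auto intro: gr0I)
  qed
  have "\<bar>s\<bar> \<le> real n * \<bar>s0\<bar>" if "h s \<le> 1" for s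
  proof (rule ccontr)
    assume "\<not> ?thesis"
    then have "h (real n * s0) \<le> h s"
      using h by (intro convex_ext_mono) (auto simp: abs_mult)
    have "h ((1 / real n) * (real n * s0)) \<le> ennreal (1 / real n) * h (real n * s0)"
      using n h by (intro convex_ext_scale) auto
    then have "of_nat n * h s0 \<le> of_nat n * (ennreal (1 / real n) * h (real n * s0))"
      using n by (intro mult_left_mono) auto
    also have "\<dots> = h (real n * s0)"
      using n by (simp add: mult.assoc[symmetric] ennreal_of_nat_eq_real_of_nat flip: ennreal_mult)
    finally show False
      using n(1) that \<open>h (real n * s0) \<le> h s\<close> by (auto dest: order_trans less_le_trans)
  qed
  then show thesis
    using that by blast
qed

section \<open>Lower semicontinuity, convexity and contractions for the energy\<close>

lemma graph_energy_ge_term: "w x y (f x - f y) \<le> graph_energy w f"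
proof -
  have "(\<Sum>(x, y)\<in>{(x, y)}. w x y (f x - f y)) \<le> graph_energy w f"
    unfolding graph_energy_def by (intro finite_sum_le_infsum_ennreal) auto
  then show ?thesis
    by simp
qed

text \<open>The energy is the supremum of its finite partial sums, and each of these is lower
  semicontinuous by superadditivity of the inferior limit.\<close>

lemma lsc_graph_energy:
  fixes w :: "'x \<Rightarrow> 'x \<Rightarrow> real \<Rightarrow> ennreal"
  assumes "\<And>x y. lsc (w x y)"
  shows "lsc (graph_energy w)"
  unfolding lsc_def
proof (intro allI impI)
  fix f :: "'x \<Rightarrow> real" and F
  assume "((\<lambda>g. g) \<longlongrightarrow> f) F"
  then have lim: "((\<lambda>g. g x) \<longlongrightarrow> f x) F" for x
    by (simp add: tendsto_fun_iff_pointwise)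
  show "graph_energy w f \<le> Liminf F (graph_energy w)"
    unfolding graph_energy_def[of w f]
  proof (rule infsum_le_finite_sums)
    fix A :: "('x \<times> 'x) set" assume "finite A"
    have "(\<Sum>(x, y)\<in>A. w x y (f x - f y)) \<le> (\<Sum>p\<in>A. Liminf F (\<lambda>g. w (fst p) (snd p) (g (fst p) - g (snd p))))"
      by (auto intro!: sum_mono lsc_tendsto[OF assms] tendsto_diff lim simp: case_prod_unfold)
    also have "\<dots> \<le> Liminf F (\<lambda>g. \<Sum>p\<in>A. w (fst p) (snd p) (g (fst p) - g (snd p)))"
      by (rule Liminf_sum_le_ennreal)
    also have "\<dots> \<le> Liminf F (graph_energy w)"
      unfolding graph_energy_def
      by (intro Liminf_mono always_eventually allI)
        (auto simp: case_prod_unfold intro!: finite_sum_le_infsum_ennreal \<open>finite A\<close>)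
    finally show "(\<Sum>(x, y)\<in>A. w x y (f x - f y)) \<le> Liminf F (graph_energy w)" .
  qed simp
qed

lemma convex_graph_energy:
  fixes w :: "'x \<Rightarrow> 'x \<Rightarrow> real \<Rightarrow> ennreal"
  assumes "\<And>x y. convex_ext (w x y)"
  shows "convex_functional (graph_energy w)"
  unfolding convex_functional_def
proof (intro allI impI)
  fix f g :: "'x \<Rightarrow> real" and u v :: real
  assume uv: "0 \<le> u" "0 \<le> v" "u + v = 1"
  have "graph_energy w (\<lambda>x. u * f x + v * g x)
      \<le> (\<Sum>\<^sub>\<infinity>(x, y). ennreal u * w x y (f x - f y) + ennreal v * w x y (g x - g y))"
    unfolding graph_energy_def
  proof (intro infsum_mono_ennreal, clarify)
    fix x y
    have "w x y (u * (f x - f y) + v * (g x - g y))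
        \<le> ennreal u * w x y (f x - f y) + ennreal v * w x y (g x - g y)"
      using uv by (intro convex_extD assms)
    then show "w x y (u * f x + v * g x - (u * f y + v * g y))
        \<le> ennreal u * w x y (f x - f y) + ennreal v * w x y (g x - g y)"
      by (simp add: algebra_simps)
  qed
  also have "\<dots> = (\<Sum>\<^sub>\<infinity>p. ennreal u * (case p of (x, y) \<Rightarrow> w x y (f x - f y)))
      + (\<Sum>\<^sub>\<infinity>p. ennreal v * (case p of (x, y) \<Rightarrow> w x y (g x - g y)))"
    by (simp add: case_prod_unfold flip: infsum_add_ennreal)
  also have "\<dots> \<le> ennreal u * graph_energy w f + ennreal v * graph_energy w g"
    unfolding graph_energy_def by (intro add_mono infsum_cmult_le_ennreal)
  finally show "graph_energy w (\<lambda>x. u * f x + v * g x)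
      \<le> ennreal u * graph_energy w f + ennreal v * graph_energy w g" .
qed

lemma graph_energy_contraction:
  fixes w :: "'x \<Rightarrow> 'x \<Rightarrow> real \<Rightarrow> ennreal"
  assumes "\<And>x y. convex_ext (w x y)" "1-lipschitz_on UNIV C"
  shows "graph_energy w (\<lambda>x. f x + C (g x)) + graph_energy w (\<lambda>x. f x - C (g x))
    \<le> graph_energy w (\<lambda>x. f x + g x) + graph_energy w (\<lambda>x. f x - g x)"
  \<comment> \<open>Merging the two sums on each side leaves a comparison for each pair of
    vertices.\<close>
  unfolding graph_energy_def infsum_add_ennreal[symmetric]
proof (intro infsum_mono_ennreal, clarify)
  fix x y
  have "\<bar>C (g x) - C (g y)\<bar> \<le> \<bar>g x - g y\<bar>"
    using lipschitz_onD[OF assms(2), of "g x" "g y"] by (simp add: dist_real_def)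
  from convex_ext_contraction[OF assms(1)[of x y] this, of "f x - f y"]
  show "w x y (f x + C (g x) - (f y + C (g y))) + w x y (f x - C (g x) - (f y - C (g y)))
      \<le> w x y (f x + g x - (f y + g y)) + w x y (f x - g x - (f y - g y))"
    by (simp add: algebra_simps)
qed

lemma graph_energy_scale:
  assumes "\<And>x y. convex_ext (w x y)" "\<And>x y. w x y 0 = 0" "0 \<le> u" "u \<le> 1"
  shows "graph_energy w (\<lambda>x. u * f x) \<le> ennreal u * graph_energy w f"
proof -
  have "convex_functional (graph_energy w)"
    by (rule convex_graph_energy[OF assms(1)])
  then have "graph_energy w (\<lambda>x. u * f x + (1 - u) * 0)
      \<le> ennreal u * graph_energy w f + ennreal (1 - u) * graph_energy w (\<lambda>x. 0)"
    unfolding convex_functional_def using assms(3,4)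
    by (elim allE[of _ f] allE[of _ "\<lambda>_. 0"] allE[of _ u] allE[of _ "1 - u"]) simp
  moreover have "graph_energy w (\<lambda>x. 0) = 0"
    unfolding graph_energy_def using assms(2) by (simp add: case_prod_unfold)
  ultimately show ?thesis
    by simp
qed

section \<open>Connectedness and finiteness of the resistance\<close>

text \<open>Symmetry of \<open>w\<close> makes the arc relation its own symmetric closure, and
  reachability within \<open>UNIV\<close> is the ordinary reflexive transitive closure.\<close>

lemma connected_weight_graph_iff:
  fixes w :: "'x \<Rightarrow> 'x \<Rightarrow> real \<Rightarrow> ennreal"
  assumes "\<And>x y. w x y = w y x"
  shows "Digraph_Component.connected (with_proj (weight_graph w))
    \<longleftrightarrow> (\<forall>x y. (x, y) \<in> {(x, y). w x y \<noteq> (\<lambda>_. 0)}\<^sup>*)"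
proof -
  let ?r = "{(x, y). w x y \<noteq> (\<lambda>_. 0)}"
  have on_UNIV: "rtrancl_on UNIV r = r\<^sup>*" for r :: "'x rel"
  proof (intro set_eqI iffI; clarify)
    show "(x, y) \<in> r\<^sup>*" if "(x, y) \<in> rtrancl_on UNIV r" for x y
      using that by induction (auto intro: rtrancl_into_rtrancl)
    show "(x, y) \<in> rtrancl_on UNIV r" if "(x, y) \<in> r\<^sup>*" for x y
      using that by induction (auto intro: rtrancl_on_into_rtrancl_on)
  qed
  have "mk_symmetric (with_proj (weight_graph w)) = \<lparr> pverts = UNIV, parcs = ?r \<rparr>"
    using assms by (auto simp: mk_symmetric_def weight_graph_def)
  moreover have "arcs_ends (with_proj \<lparr> pverts = UNIV, parcs = ?r \<rparr>) = ?r"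
    by (auto simp: arcs_ends_def arc_to_ends_def)
  ultimately show ?thesis
    by (simp add: Digraph_Component.connected_def strongly_connected_def reachable_def on_UNIV)
qed

text \<open>Induction along a path, adding one bound per edge. That \<open>T\<close> is chosen
  before \<open>f\<close> turns it into a bound on the resistance.\<close>

lemma graph_energy_path_bound:
  fixes w :: "'x \<Rightarrow> 'x \<Rightarrow> real \<Rightarrow> ennreal"
  assumes "\<And>x y s. w x y (- s) = w x y s" "\<And>x y. convex_ext (w x y)" "\<And>x y. w x y 0 = 0"
    and "(x, y) \<in> {(x, y). w x y \<noteq> (\<lambda>_. 0)}\<^sup>*"
  shows "\<exists>T. \<forall>f. graph_energy w f \<le> 1 \<longrightarrow> \<bar>f x - f y\<bar> \<le> T"
  using assms(4)
proof induction
  case base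
  show ?case by (auto intro: exI[of _ 0])
next
  case (step y z)
  then obtain T where T: "\<And>f. graph_energy w f \<le> 1 \<Longrightarrow> \<bar>f x - f y\<bar> \<le> T"
    by blast
  have "w y z \<noteq> (\<lambda>_. 0)"
    using step by auto
  then obtain T' where T': "\<And>s. w y z s \<le> 1 \<Longrightarrow> \<bar>s\<bar> \<le> T'"
    using convex_ext_bounded_sublevel[OF assms(2,1,3)] by metis
  have "\<bar>f x - f z\<bar> \<le> T + T'" if "graph_energy w f \<le> 1" for f
    using T[OF that] T'[OF order_trans[OF graph_energy_ge_term that]] by linarith
  then show ?case
    by blast
qed

text \<open>The set is the component of \<open>x\<close>. An edge has both ends inside or both
  outside, so its increment is 0; pairs that are not edges have zero weight.\<close>

lemma graph_energy_indicator_component: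
  fixes w :: "'x \<Rightarrow> 'x \<Rightarrow> real \<Rightarrow> ennreal"
  assumes "\<And>x y. w x y 0 = 0" "\<And>x y. w x y = w y x"
  shows "graph_energy w (\<lambda>y. c * indicator ({(x, y). w x y \<noteq> (\<lambda>_. 0)}\<^sup>* `` {x}) y) = 0"
proof -
  let ?r = "{(x, y). w x y \<noteq> (\<lambda>_. 0)}"
  have step: "v \<in> ?r\<^sup>* `` {x}" if "u \<in> ?r\<^sup>* `` {x}" "w u v \<noteq> (\<lambda>_. 0)" for u v
    using that by (auto intro: rtrancl_into_rtrancl)
  have "w u v (c * indicator (?r\<^sup>* `` {x}) u - c * indicator (?r\<^sup>* `` {x}) v) = 0" for u v
  proof (cases "w u v = (\<lambda>_. 0)")
    case False
    then have "u \<in> ?r\<^sup>* `` {x} \<longleftrightarrow> v \<in> ?r\<^sup>* `` {x}"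
      \<comment> \<open>Symmetry of \<open>w\<close> allows the edge to be followed in either
        direction.\<close>
      using step[of u v] step[of v u] assms(2)[of u v] by metis
    then show ?thesis
      using assms(1) by (simp add: indicator_def)
  qed simp
  then show ?thesis
    unfolding graph_energy_def by (simp add: case_prod_unfold)
qed

lemma graph_energy_resistance_form_iff:
  fixes w :: "'x \<Rightarrow> 'x \<Rightarrow> real \<Rightarrow> ennreal"
  assumes w: "\<And>x y s. w x y (- s) = w x y s" "\<And>x y. lsc (w x y)" "\<And>x y. convex_ext (w x y)"
    "\<And>x y. w x y 0 = 0" "\<And>x y. w x y = w y x"
  shows "nonlinear_resistance_form (graph_energy w)
    \<longleftrightarrow> (\<forall>x y. (x, y) \<in> {(x, y). w x y \<noteq> (\<lambda>_. 0)}\<^sup>*)"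
proof (intro iffI allI)
  fix x y
  assume form: "nonlinear_resistance_form (graph_energy w)"
  let ?A = "{(x, y). w x y \<noteq> (\<lambda>_. 0)}\<^sup>* `` {x}"
  show "(x, y) \<in> {(x, y). w x y \<noteq> (\<lambda>_. 0)}\<^sup>*"
  proof (rule ccontr)
    assume "\<not> ?thesis"
    then have "x \<in> ?A" "y \<notin> ?A"
      by auto
    \<comment> \<open>A function of energy 0 has difference \<open>c\<close> between
      \<open>x\<close> and \<open>y\<close>, and \<open>c\<close> is arbitrary.\<close>
    have "ereal c \<le> resistance (graph_energy w) x y" for c
    proof -
      have "ereal (c * indicator ?A x - c * indicator ?A y) \<le> resistance (graph_energy w) x y"
        unfolding resistance_def
        by (rule SUP_upper) (simp add: graph_energy_indicator_component[where w = w, OF w(4,5)])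
      then show ?thesis
        using \<open>x \<in> ?A\<close> \<open>y \<notin> ?A\<close> by simp
    qed
    then have "resistance (graph_energy w) x y = \<infinity>"
      by (intro ereal_top)
    then show False
      using form unfolding nonlinear_resistance_form_def by (metis less_irrefl)
  qed
next
  assume conn: "\<forall>x y. (x, y) \<in> {(x, y). w x y \<noteq> (\<lambda>_. 0)}\<^sup>*"
  have "resistance (graph_energy w) x y < \<infinity>" for x y
  proof -
    obtain T where T: "\<And>f. graph_energy w f \<le> 1 \<Longrightarrow> \<bar>f x - f y\<bar> \<le> T"
      using graph_energy_path_bound[where w = w, OF w(1,3,4)] conn by metis
    have "resistance (graph_energy w) x y \<le> ereal T"
      unfolding resistance_def by (intro SUP_least) (use T in \<open>auto simp: abs_le_iff\<close>)
    then show ?thesis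
      by (rule le_less_trans) simp
  qed
  moreover have "graph_energy w (\<lambda>_. 0) = 0"
    unfolding graph_energy_def using w(4) by (simp add: case_prod_unfold)
  ultimately show "nonlinear_resistance_form (graph_energy w)"
    unfolding nonlinear_resistance_form_def
    using convex_graph_energy[where w = w, OF w(3)] lsc_graph_energy[where w = w, OF w(2)]
      graph_energy_contraction[where w = w, OF w(3)] by blast
qed

section \<open>Finitely supported functions and the modular space\<close>

text \<open>Only pairs meeting the support contribute. Once the increments are small, each such term
  is dominated by a term of the convergent sum at an endpoint in the support, and there are finitely
  many such sums.\<close>

lemma graph_energy_finite_multiple:
  fixes w :: "'x \<Rightarrow> 'x \<Rightarrow> real \<Rightarrow> ennreal"
  assumes w: "\<And>x y s. w x y (- s) = w x y s" "\<And>x y. convex_ext (w x y)"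
    "\<And>x y. w x y 0 = 0" "\<And>x y. w x y = w y x"
    and "\<And>x. \<exists>t>0. (\<Sum>\<^sub>\<infinity>y. w x y t) < \<infinity>"
    and "finite {x. f x \<noteq> 0}"
  shows "\<exists>\<alpha>>0. graph_energy w (\<lambda>x. \<alpha> * f x) < \<infinity>"
proof -
  obtain t where t: "\<And>x. t x > 0" "\<And>x. (\<Sum>\<^sub>\<infinity>y. w x y (t x)) < \<infinity>"
    using assms(5) by metis
  define S where "S = {x. f x \<noteq> 0}"
  have "finite S"
    using assms(6) by (simp add: S_def)
  \<comment> \<open>The summand 1 keeps \<open>M\<close> positive for empty support.\<close>
  define M where "M = 1 + (\<Sum>x\<in>S. \<bar>f x\<bar>)"
  have "M > 0"
    unfolding M_def by (intro add_pos_nonneg sum_nonneg) auto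
  have f_le: "\<bar>f x\<bar> \<le> M" for x
  proof (cases "x \<in> S")
    case True
    then have "\<bar>f x\<bar> \<le> (\<Sum>x\<in>S. \<bar>f x\<bar>)"
      using \<open>finite S\<close> by (intro member_le_sum) auto
    then show ?thesis
      by (simp add: M_def)
  qed (use \<open>M > 0\<close> in \<open>simp add: S_def\<close>)
  \<comment> \<open>Inserting 1 makes the minimum meaningful for empty \<open>S\<close>.\<close>
  define m where "m = Min (insert 1 (t ` S))"
  have "m > 0" and m_le: "\<And>x. x \<in> S \<Longrightarrow> m \<le> t x"
    using t(1) \<open>finite S\<close> by (auto simp: m_def)
  \<comment> \<open>Increments of \<open>f\<close> are at most \<open>2 * M\<close>, so those of the
    multiple are at most \<open>m\<close>.\<close>
  define \<alpha> where "\<alpha> = m / (2 * M)"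
  have "\<alpha> > 0"
    using \<open>m > 0\<close> \<open>M > 0\<close> by (simp add: \<alpha>_def)
  have diff: "\<bar>\<alpha> * f x - \<alpha> * f y\<bar> \<le> m" for x y
  proof -
    have "\<bar>\<alpha> * f x - \<alpha> * f y\<bar> = \<alpha> * \<bar>f x - f y\<bar>"
      using \<open>\<alpha> > 0\<close> by (simp add: abs_mult flip: right_diff_distrib)
    also have "\<dots> \<le> \<alpha> * (2 * M)"
      using \<open>\<alpha> > 0\<close> f_le[of x] f_le[of y] by (intro mult_left_mono) auto
    finally show ?thesis
      using \<open>M > 0\<close> by (simp add: \<alpha>_def)
  qed
  \<comment> \<open>\<open>h\<close> charges a pair to its first vertex; the symmetrized
    \<open>h x y + h y x\<close> covers pairs with either end in \<open>S\<close>.\<close>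
  define h where "h x y = (if x \<in> S then w x y (t x) else 0)" for x y
  have term_le: "w x y (\<alpha> * f x - \<alpha> * f y) \<le> h x y + h y x" for x y
  proof -
    \<comment> \<open>The weight indices are decoupled from the increment so that the pair can also
      be used reversed; only the size of the increment matters.\<close>
    have *: "w u v (\<alpha> * f x - \<alpha> * f y) \<le> h u v" if "u \<in> S" for u v
      unfolding h_def using that diff[of x y] m_le[OF that] t(1)[of u]
      by (auto intro!: convex_ext_mono w)
    consider "x \<in> S" | "y \<in> S" | "f x = 0" "f y = 0"
      by (auto simp: S_def)
    then show ?thesis
    proof cases
      case 1
      then show ?thesis
        using *[of x y] by (auto intro: add_increasing2)
    next
      case 2
      then show ?thesis
        using *[of y x] w(4)[of x y] by (auto intro: add_increasing)
    qed (simp add: w)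
  qed
  define B where "B = (\<Sum>x\<in>S. \<Sum>\<^sub>\<infinity>y. w x y (t x))"
  have "graph_energy w (\<lambda>x. \<alpha> * f x) \<le> B + B"
    unfolding graph_energy_def
  proof (rule infsum_le_finite_sums)
    fix P :: "('x \<times> 'x) set" assume "finite P"
    \<comment> \<open>Enlarging \<open>P\<close> to a square allows the order of summation to be
      swapped, which identifies the two halves of the symmetrized sum.\<close>
    define Q where "Q = fst ` P \<union> snd ` P"
    have "finite Q" "P \<subseteq> Q \<times> Q"
      using \<open>finite P\<close> by (force simp: Q_def)+
    have "(\<Sum>(x, y)\<in>P. w x y (\<alpha> * f x - \<alpha> * f y)) \<le> (\<Sum>(x, y)\<in>P. h x y + h y x)"
      by (auto intro!: sum_mono term_le)
    also have "\<dots> \<le> (\<Sum>(x, y)\<in>Q \<times> Q. h x y + h y x)"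
      using \<open>finite Q\<close> \<open>P \<subseteq> Q \<times> Q\<close> by (intro sum_mono2) auto
    also have "\<dots> = (\<Sum>x\<in>Q. \<Sum>y\<in>Q. h x y) + (\<Sum>x\<in>Q. \<Sum>y\<in>Q. h y x)"
      by (simp add: sum.distrib flip: sum.cartesian_product)
    also have "(\<Sum>x\<in>Q. \<Sum>y\<in>Q. h y x) = (\<Sum>x\<in>Q. \<Sum>y\<in>Q. h x y)"
      by (rule sum.swap)
    also have "(\<Sum>x\<in>Q. \<Sum>y\<in>Q. h x y) = (\<Sum>x\<in>Q \<inter> S. \<Sum>y\<in>Q. h x y)"
      using \<open>finite Q\<close> by (intro sum.mono_neutral_right) (auto simp: h_def)
    also have "\<dots> = (\<Sum>x\<in>Q \<inter> S. \<Sum>y\<in>Q. w x y (t x))"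
      by (auto intro!: sum.cong simp: h_def)
    also have "\<dots> \<le> (\<Sum>x\<in>Q \<inter> S. \<Sum>\<^sub>\<infinity>y. w x y (t x))"
      using \<open>finite Q\<close> by (intro sum_mono finite_sum_le_infsum_ennreal) auto
    also have "\<dots> \<le> B"
      unfolding B_def using \<open>finite S\<close> by (intro sum_mono2) auto
    finally show "(\<Sum>(x, y)\<in>P. w x y (\<alpha> * f x - \<alpha> * f y)) \<le> B + B"
      \<comment> \<open>The bound by \<open>B\<close> is applied to both equal halves, using that
        doubling is monotone.\<close>
      by (simp add: add_mono)
  qed simp
  also have "B + B < \<infinity>"
    unfolding B_def using t(2) \<open>finite S\<close> by simp
  finally show ?thesis
    using \<open>\<alpha> > 0\<close> by blast
qed

text \<open>One positive multiple of finite energy suffices: below \<open>a\<close>, convexity makes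
  the energy decay at least linearly as the factor tends to 0.\<close>

lemma modular_M_graph_energyI:
  fixes w :: "'x \<Rightarrow> 'x \<Rightarrow> real \<Rightarrow> ennreal"
  assumes w: "\<And>x y. convex_ext (w x y)" "\<And>x y. w x y 0 = 0"
    and a: "a > 0" "graph_energy w (\<lambda>x. a * f x) < \<infinity>"
  shows "f \<in> modular_M (graph_energy w)"
proof -
  have "\<forall>\<^sub>F \<alpha> in at_right 0. \<alpha> < a"
    using a(1) by (auto simp: eventually_at_right_field)
  moreover have "\<forall>\<^sub>F \<alpha> in at_right 0. \<alpha> > (0::real)"
    by (simp add: eventually_at_right_less)
  ultimately have bound: "\<forall>\<^sub>F \<alpha> in at_right 0.
      graph_energy w (\<lambda>x. \<alpha> * f x) \<le> ennreal (\<alpha> / a) * graph_energy w (\<lambda>x. a * f x)"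
  proof eventually_elim
    case (elim \<alpha>)
    have "graph_energy w (\<lambda>x. (\<alpha> / a) * (a * f x))
        \<le> ennreal (\<alpha> / a) * graph_energy w (\<lambda>x. a * f x)"
      using elim a by (intro graph_energy_scale w) auto
    then show ?case
      using a by simp
  qed
  have "((\<lambda>\<alpha>. \<alpha> / a) \<longlongrightarrow> 0 / a) (at_right 0)"
    using a by (intro tendsto_intros) auto
  then have "((\<lambda>\<alpha>. ennreal (\<alpha> / a)) \<longlongrightarrow> 0) (at_right 0)"
    using tendsto_ennrealI by fastforce
  then have "((\<lambda>\<alpha>. ennreal (\<alpha> / a) * graph_energy w (\<lambda>x. a * f x))
      \<longlongrightarrow> 0 * graph_energy w (\<lambda>x. a * f x)) (at_right 0)"
    \<comment> \<open>Finiteness of the energy excludes the discontinuity of multiplication at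
      \<open>0 * \<infinity>\<close>.\<close>
    using a(2) by (intro tendsto_mult_ennreal tendsto_const) auto
  then show ?thesis
    unfolding modular_M_def
    by (auto intro: tendsto_sandwich[OF _ bound tendsto_const])
qed

theorem proposition5p3:
  fixes w :: "'x \<Rightarrow> 'x \<Rightarrow> real \<Rightarrow> ennreal"
  assumes "countable (UNIV :: 'x set)"
    and "\<And>x y s. w x y (- s) = w x y s"
    and "\<And>x y. lsc (w x y)"
    and "\<And>x y. convex_ext (w x y)"
    and "\<And>x y. w x y 0 = 0"
    and "\<And>x y. w x y = w y x"
  shows "(nonlinear_resistance_form (graph_energy w)
           \<longleftrightarrow> Digraph_Component.connected (with_proj (weight_graph w)))
         \<and> ((\<forall>x. \<exists>t>0. (\<Sum>\<^sub>\<infinity>y. w x y t) < \<infinity>) \<longrightarrow>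
           finitely_supported \<subseteq> modular_M (graph_energy w) \<and>
           separates_points (domain_D (graph_energy w)))"
proof (intro conjI impI)
  show "nonlinear_resistance_form (graph_energy w)
      \<longleftrightarrow> Digraph_Component.connected (with_proj (weight_graph w))"
    using graph_energy_resistance_form_iff[where w = w, OF assms(2-6)]
      connected_weight_graph_iff[where w = w, OF assms(6)] by simp
next
  assume "\<forall>x. \<exists>t>0. (\<Sum>\<^sub>\<infinity>y. w x y t) < \<infinity>"
  then have multiple: "\<exists>\<alpha>>0. graph_energy w (\<lambda>x. \<alpha> * f x) < \<infinity>" if "f \<in> finitely_supported" for f
    using that graph_energy_finite_multiple[where w = w, OF assms(2,4-6)]
    by (simp add: finitely_supported_def)
  show "finitely_supported \<subseteq> modular_M (graph_energy w)"
    using multiple modular_M_graph_energyI[where w = w, OF assms(4,5)] by blast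
  show "separates_points (domain_D (graph_energy w))"
    unfolding separates_points_def
  proof (intro allI impI)
    fix x y :: 'x assume "x \<noteq> y"
    \<comment> \<open>The indicator itself may have infinite energy, but a positive multiple of
      finite energy still separates \<open>x\<close> from \<open>y\<close>.\<close>
    have "indicator {x} \<in> finitely_supported"
      by (simp add: finitely_supported_def indicator_def)
    from multiple[OF this] obtain \<alpha> :: real
      where "\<alpha> > 0" "graph_energy w (\<lambda>z. \<alpha> * indicator {x} z) < \<infinity>"
      by blast
    then show "\<exists>f\<in>domain_D (graph_energy w). f x \<noteq> f y"
      using \<open>x \<noteq> y\<close> by (intro bexI[of _ "\<lambda>z. \<alpha> * indicator {x} z"]) (auto simp: domain_D_def)
  qed
qed

end
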